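(* Let $P:\mathcal{C}^{\mathrm{op}}\to\mathbf{Hey}$ be a Gödel first-order hyperdoctrine such that existential-free elements are closed with respect to implication and $\bot$ is a quantifier-free predicate. Then $P$ satisfies Markov Principle, i.e. for all objects $A,B$ of $\mathcal{C}$ and every quantifier-free element $\alpha_D\in P(A\times B)$ it is the case that $$b:B\mid \top\vdash \neg\forall a:A.\,\alpha_D(a,b)\to\exists a:A.\,\neg\alpha_D(a,b).$$
   Context: A doctrine is a functor $P:\mathcal{C}^{\mathrm{op}}\to\mathbf{Pos}$, where $\mathcal{C}$ has finite products and $\mathbf{Pos}$ is the category of posets and monotone maps. For $f:A\to B$ in $\mathcal{C}$ write $P_f:P(B)\to P(A)$. Elements of $P(A)$ are called predicates. $P$ is existential (resp. universal) if for every product projection $\pi_i:A_1\times A_2\to A_i$ the map $P_{\pi_i}$ has a left adjoint $\exists_{\pi_i}$ (resp. a right adjoint $\forall_{\pi_i}$) and the Beck-Chevalley condition holds: for every pullback square $\pi f'=f\pi'$ with $\pi:X\to A$ and $\pi':X'\to A'$ projections, $f:A'\to A$, $f':X'\to X$, and every $\beta\in P(X)$, $\exists_{\pi'}P_{f'}\beta=P_f\exists_\pi\beta$ (resp. $\forall_{\pi'}P_{f'}\beta=P_f\forall_\pi\beta$). Internal language: $a:A\mid\phi(a)\vdash\psi(a)$ means $\phi\le\psi$ in $P(A)$ (a context with several variables denotes the product of the types). For $\alpha\in P(A\times B)$, $\exists b:B.\,\alpha(a,b)$ and $\forall b:B.\,\alpha(a,b)$ denote $\exists_{\pi_A}\alpha$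 and $\forall_{\pi_A}\alpha$ in $P(A)$, and similarly for quantification over $A$. Terms are arrows of $\mathcal{C}$ and substitution is reindexing, e.g. $\alpha(a,g(a))$ is $P_{\langle 1_A,g\rangle}\alpha$. Propositional connectives are interpreted by the operations of the fibres; $\neg\phi$ is $\phi\to\bot$. Let $P$ be existential. $\alpha\in P(A)$ is an existential splitting if for every object $B$ and every $\beta\in P(A\times B)$ with $\alpha(a)\vdash\exists b:B.\,\beta(a,b)$ there is $g:A\to B$ with $\alpha(a)\vdash\beta(a,g(a))$. $\alpha\in P(I)$ is existential-free if $P_f(\alpha)$ is an existential splitting for every arrow $f:A\to I$. $P$ has enough existential-free predicates if for every $I$ and $\alpha\in P(I)$ there are an object $A$ and an existential-free $\beta\in P(I\times A)$ with $\alpha=\exists_{\pi_I}\beta$. $P^{\exists\text{-free}}$ denotes the subdoctrine of $P$ (same base) whose fibre over $A$ is the set of existential-free elements of $P(A)$ with the induced order. Dually, for $P$ universal, $\alpha\in P(A)$ is a universal splitting if for every $B$ and every $\beta\in P(A\times B)$ with $\forall b:B.\,\beta(a,b)\vdash\alpha(a)$ there is $g:A\to B$ with $\beta(a,g(a))\vdash\alpha(a)$. $\alpha\in P(I)$ is universal-free if $P_f(\alpha)$ is a universal splitting for every $f:A\to I$. $P$ has enough universal-free predicates if for every $I$ and $\alpha\in P(I)$ there are $A$ and a universal-free $\beta\in P(I\times A)$ with $\alpha=\forall_{\pi_I}\beta$. $P$ is a Skolem doctrine if: (i) $\mathcal{C}$ is cartesian closed; (ii) $P$ is existential and universal; (iii)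 $P$ has enough existential-free predicates; (iv) if $\alpha\in P(A)$ is existential-free then $\forall_\pi(\alpha)$ is existential-free for every projection $\pi$ from $A$ (so $P^{\exists\text{-free}}$ is a universal doctrine, with universal quantifiers those of $P$). $P$ is a Gödel doctrine if it is a Skolem doctrine and the doctrine $P^{\exists\text{-free}}$ has enough universal-free predicates. A predicate of a Gödel doctrine $P$ is quantifier-free if it is existential-free in $P$ and universal-free in the doctrine $P^{\exists\text{-free}}$ (universal-freeness being tested only against $\beta$ in $P^{\exists\text{-free}}$). A first-order hyperdoctrine is a functor $P:\mathcal{C}^{\mathrm{op}}\to\mathbf{Hey}$ from a category $\mathcal{C}$ with finite products to Heyting algebras and their homomorphisms such that for every arrow $f$ the map $P_f$ has a left adjoint $\exists_f$ and a right adjoint $\forall_f$, satisfying Beck-Chevalley for every pullback square $fh=gk$ ($h:D\to A$, $k:D\to C$, $f:A\to B$, $g:C\to B$): $\exists_kP_h=P_g\exists_f$ and $\forall_kP_h=P_g\forall_f$. It is a Gödel first-order hyperdoctrine if $P$ is a Gödel doctrine. "$\bot$ is a quantifier-free predicate" means that the bottom element of each fibre is quantifier-free. *)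

theory Defs
  imports "HOL-Algebra.Galois_Connection"
begin

section \<open>Categories with finite products\<close>

record ('o, 'm) category =
  Obj :: "'o set"
  Arr :: "'m set"
  Dom :: "'m \<Rightarrow> 'o"
  Cod :: "'m \<Rightarrow> 'o"
  Idn :: "'o \<Rightarrow> 'm"
  Comp :: "'m \<Rightarrow> 'm \<Rightarrow> 'm"  (infixr \<open>\<odot>\<index>\<close> 70)

definition homset :: "('o, 'm, 'z) category_scheme \<Rightarrow> 'o \<Rightarrow> 'o \<Rightarrow> 'm set" where
  "homset C A B = {f \<in> Arr C. Dom C f = A \<and> Cod C f = B}"

text \<open>Composition is in applicative order: \<open>g \<odot> f\<close> is \<open>f\<close> followed by \<open>g\<close>.\<close>

locale category =
  fixes C :: "('o, 'm, 'z) category_scheme" (structure)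
  assumes dom_obj: "f \<in> Arr C \<Longrightarrow> Dom C f \<in> Obj C"
    and cod_obj: "f \<in> Arr C \<Longrightarrow> Cod C f \<in> Obj C"
    and idn_hom: "A \<in> Obj C \<Longrightarrow> Idn C A \<in> homset C A A"
    and comp_hom: "f \<in> homset C A B \<Longrightarrow> g \<in> homset C B D \<Longrightarrow> g \<odot> f \<in> homset C A D"
    and comp_idn_right: "f \<in> homset C A B \<Longrightarrow> f \<odot> Idn C A = f"
    and comp_idn_left: "f \<in> homset C A B \<Longrightarrow> Idn C B \<odot> f = f"
    and comp_assoc: "f \<in> homset C A B \<Longrightarrow> g \<in> homset C B D \<Longrightarrow> h \<in> homset C D E \<Longrightarrow>
      (h \<odot> g) \<odot> f = h \<odot> (g \<odot> f)"

definition is_terminal :: "('o, 'm, 'z) category_scheme \<Rightarrow> 'o \<Rightarrow> bool" where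
  "is_terminal C T \<longleftrightarrow> T \<in> Obj C \<and> (\<forall>A \<in> Obj C. \<exists>!f. f \<in> homset C A T)"

text \<open>Products are not chosen: \<open>is_product C A B X p q\<close> says that the span
  \<open>A \<leftarrow> X \<rightarrow> B\<close> formed by \<open>p\<close> and \<open>q\<close> is some product of \<open>A\<close> and \<open>B\<close>, and everything
  that mentions \<open>A \<times> B\<close> refers to such spans.\<close>

definition is_product ::
  "('o, 'm, 'z) category_scheme \<Rightarrow> 'o \<Rightarrow> 'o \<Rightarrow> 'o \<Rightarrow> 'm \<Rightarrow> 'm \<Rightarrow> bool" where
  "is_product C A B X p q \<longleftrightarrow> p \<in> homset C X A \<and> q \<in> homset C X B \<and>
    (\<forall>Y \<in> Obj C. \<forall>f \<in> homset C Y A. \<forall>g \<in> homset C Y B.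
      \<exists>!h. h \<in> homset C Y X \<and> p \<odot>\<^bsub>C\<^esub> h = f \<and> q \<odot>\<^bsub>C\<^esub> h = g)"

text \<open>By symmetry of \<open>is_product\<close> this covers both projections of a product.\<close>

definition is_projection :: "('o, 'm, 'z) category_scheme \<Rightarrow> 'm \<Rightarrow> bool" where
  "is_projection C p \<longleftrightarrow> (\<exists>A B X q. is_product C A B X p q)"

text \<open>The arrow \<open>\<langle>f, g\<rangle>\<close> into the product with projections \<open>p\<close> and \<open>q\<close>.\<close>

definition pairing :: "('o, 'm, 'z) category_scheme \<Rightarrow> 'm \<Rightarrow> 'm \<Rightarrow> 'm \<Rightarrow> 'm \<Rightarrow> 'm" where
  "pairing C p q f g =
    (THE h. h \<in> homset C (Dom C f) (Dom C p) \<and> p \<odot>\<^bsub>C\<^esub> h = f \<and> q \<odot>\<^bsub>C\<^esub> h = g)"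

text \<open>The square \<open>f \<odot> h = g \<odot> k\<close> is a pullback.\<close>

definition is_pullback ::
  "('o, 'm, 'z) category_scheme \<Rightarrow> 'm \<Rightarrow> 'm \<Rightarrow> 'm \<Rightarrow> 'm \<Rightarrow> bool" where
  "is_pullback C f g h k \<longleftrightarrow>
    (\<exists>A B D E. f \<in> homset C A B \<and> g \<in> homset C E B \<and> h \<in> homset C D A \<and> k \<in> homset C D E \<and>
      f \<odot>\<^bsub>C\<^esub> h = g \<odot>\<^bsub>C\<^esub> k \<and>
      (\<forall>Y \<in> Obj C. \<forall>u \<in> homset C Y A. \<forall>v \<in> homset C Y E. f \<odot>\<^bsub>C\<^esub> u = g \<odot>\<^bsub>C\<^esub> v \<longrightarrow>
        (\<exists>!w. w \<in> homset C Y D \<and> h \<odot>\<^bsub>C\<^esub> w = u \<and> k \<odot>\<^bsub>C\<^esub> w = v)))"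

locale finite_product_category = category C for C :: "('o, 'm, 'z) category_scheme" (structure) +
  assumes has_terminal: "\<exists>T. is_terminal C T"
    and has_products: "A \<in> Obj C \<Longrightarrow> B \<in> Obj C \<Longrightarrow> \<exists>X p q. is_product C A B X p q"

text \<open>\<open>E\<close> is an exponential \<open>B\<^sup>A\<close>: \<open>X\<close> is the product \<open>E \<times> A\<close> and \<open>ev : X \<rightarrow> B\<close> is
  the evaluation; every \<open>f : D \<times> A \<rightarrow> B\<close> is \<open>ev \<odot> (g \<times> 1)\<close> for a unique \<open>g : D \<rightarrow> E\<close>.\<close>

definition is_exponential ::
  "('o, 'm, 'z) category_scheme \<Rightarrow> 'o \<Rightarrow> 'o \<Rightarrow> 'o \<Rightarrow> 'o \<Rightarrow> 'm \<Rightarrow> 'm \<Rightarrow> 'm \<Rightarrow> bool" where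
  "is_exponential C A B E X p q ev \<longleftrightarrow> is_product C E A X p q \<and> ev \<in> homset C X B \<and>
    (\<forall>D Y r s f. is_product C D A Y r s \<and> f \<in> homset C Y B \<longrightarrow>
      (\<exists>!g. g \<in> homset C D E \<and> ev \<odot>\<^bsub>C\<^esub> pairing C p q (g \<odot>\<^bsub>C\<^esub> r) s = f))"

locale cartesian_closed_category =
  finite_product_category C for C :: "('o, 'm, 'z) category_scheme" (structure) +
  assumes has_exponentials:
    "A \<in> Obj C \<Longrightarrow> B \<in> Obj C \<Longrightarrow> \<exists>E X p q ev. is_exponential C A B E X p q ev"


section \<open>Heyting algebras\<close>

locale heyting_algebra = bounded_lattice L for L (structure) +
  assumes imp_exists: "x \<in> carrier L \<Longrightarrow> y \<in> carrier L \<Longrightarrow>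
    \<exists>z. greatest L z {w \<in> carrier L. w \<sqinter> x \<sqsubseteq> y}"

definition himp :: "('p, 'z) gorder_scheme \<Rightarrow> 'p \<Rightarrow> 'p \<Rightarrow> 'p" where
  "himp L x y = (THE z. greatest L z {w \<in> carrier L. w \<sqinter>\<^bsub>L\<^esub> x \<sqsubseteq>\<^bsub>L\<^esub> y})"

definition hneg :: "('p, 'z) gorder_scheme \<Rightarrow> 'p \<Rightarrow> 'p" where
  "hneg L x = himp L x \<bottom>\<^bsub>L\<^esub>"

definition heyting_hom ::
  "('p, 'y) gorder_scheme \<Rightarrow> ('q, 'z) gorder_scheme \<Rightarrow> ('p \<Rightarrow> 'q) \<Rightarrow> bool" where
  "heyting_hom L M h \<longleftrightarrow> h \<in> carrier L \<rightarrow> carrier M \<and> meet_pres L M h \<and> join_pres L M h \<and>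
    h \<top>\<^bsub>L\<^esub> = \<top>\<^bsub>M\<^esub> \<and> h \<bottom>\<^bsub>L\<^esub> = \<bottom>\<^bsub>M\<^esub> \<and>
    (\<forall>x \<in> carrier L. \<forall>y \<in> carrier L. h (himp L x y) = himp M (h x) (h y))"


section \<open>Doctrines\<close>

text \<open>A doctrine is stored together with its base category. For \<open>f : A \<rightarrow> B\<close>,
  \<open>reindex P f\<close> is the map from the fibre over \<open>B\<close> to the fibre over \<open>A\<close>.\<close>

record ('o, 'm, 'p) doctrine = "('o, 'm) category" +
  fibre :: "'o \<Rightarrow> 'p gorder"
  reindex :: "'m \<Rightarrow> 'p \<Rightarrow> 'p"

abbreviation pred :: "('o, 'm, 'p) doctrine \<Rightarrow> 'o \<Rightarrow> 'p set" where
  "pred P A \<equiv> carrier (fibre P A)"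

locale doctrine = finite_product_category P for P :: "('o, 'm, 'p) doctrine" (structure) +
  assumes fibre_order: "A \<in> Obj P \<Longrightarrow> partial_order (fibre P A)"
    and reindex_closed: "f \<in> homset P A B \<Longrightarrow> reindex P f \<in> pred P B \<rightarrow> pred P A"
    and reindex_mono: "f \<in> homset P A B \<Longrightarrow> isotone (fibre P B) (fibre P A) (reindex P f)"
    and reindex_idn: "A \<in> Obj P \<Longrightarrow> \<alpha> \<in> pred P A \<Longrightarrow> reindex P (Idn P A) \<alpha> = \<alpha>"
    and reindex_comp: "f \<in> homset P A B \<Longrightarrow> g \<in> homset P B D \<Longrightarrow> \<alpha> \<in> pred P D \<Longrightarrow>
      reindex P (g \<odot> f) \<alpha> = reindex P f (reindex P g \<alpha>)"

text \<open>In the sense of \<^theory>\<open>HOL-Algebra.Galois_Connection\<close>, \<open>f\<close> is the upper adjoint in the first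
  definition and the lower adjoint in the second. Adjoints are unique on the carriers (see
  \<open>ex_along_eq\<close> and \<open>all_along_eq\<close> below); outside them, or if there is no adjoint,
  the values of \<open>ex_along\<close> and \<open>all_along\<close> are arbitrary.\<close>

definition ex_along :: "('o, 'm, 'p) doctrine \<Rightarrow> 'm \<Rightarrow> 'p \<Rightarrow> 'p" where
  "ex_along P f = (SOME e. galois_connection
    \<lparr>orderA = fibre P (Dom P f), orderB = fibre P (Cod P f), lower = e, upper = reindex P f\<rparr>)"

definition all_along :: "('o, 'm, 'p) doctrine \<Rightarrow> 'm \<Rightarrow> 'p \<Rightarrow> 'p" where
  "all_along P f = (SOME u. galois_connection
    \<lparr>orderA = fibre P (Cod P f), orderB = fibre P (Dom P f), lower = reindex P f, upper = u\<rparr>)"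

definition has_ex_along :: "('o, 'm, 'p) doctrine \<Rightarrow> 'm \<Rightarrow> bool" where
  "has_ex_along P f \<longleftrightarrow> upper_adjoint (fibre P (Dom P f)) (fibre P (Cod P f)) (reindex P f)"

definition has_all_along :: "('o, 'm, 'p) doctrine \<Rightarrow> 'm \<Rightarrow> bool" where
  "has_all_along P f \<longleftrightarrow> lower_adjoint (fibre P (Cod P f)) (fibre P (Dom P f)) (reindex P f)"

text \<open>Beck-Chevalley for the square \<open>f \<odot> h = g \<odot> k\<close>, with quantification along \<open>f\<close> and \<open>k\<close>.\<close>

definition ex_beck_chevalley :: "('o, 'm, 'p) doctrine \<Rightarrow> 'm \<Rightarrow> 'm \<Rightarrow> 'm \<Rightarrow> 'm \<Rightarrow> bool" where
  "ex_beck_chevalley P f g h k \<longleftrightarrow> (\<forall>\<beta> \<in> pred P (Dom P f).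
    ex_along P k (reindex P h \<beta>) = reindex P g (ex_along P f \<beta>))"

definition all_beck_chevalley :: "('o, 'm, 'p) doctrine \<Rightarrow> 'm \<Rightarrow> 'm \<Rightarrow> 'm \<Rightarrow> 'm \<Rightarrow> bool" where
  "all_beck_chevalley P f g h k \<longleftrightarrow> (\<forall>\<beta> \<in> pred P (Dom P f).
    all_along P k (reindex P h \<beta>) = reindex P g (all_along P f \<beta>))"

locale existential_doctrine = doctrine P for P :: "('o, 'm, 'p) doctrine" (structure) +
  assumes ex_adjoint: "is_projection P p \<Longrightarrow> has_ex_along P p"
    and ex_bc: "is_pullback P p f f' p' \<Longrightarrow> is_projection P p \<Longrightarrow> is_projection P p' \<Longrightarrow>
      ex_beck_chevalley P p f f' p'"

locale universal_doctrine = doctrine P for P :: "('o, 'm, 'p) doctrine" (structure) +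
  assumes all_adjoint: "is_projection P p \<Longrightarrow> has_all_along P p"
    and all_bc: "is_pullback P p f f' p' \<Longrightarrow> is_projection P p \<Longrightarrow> is_projection P p' \<Longrightarrow>
      all_beck_chevalley P p f f' p'"


section \<open>Existential-free and universal-free predicates\<close>

definition existential_splitting :: "('o, 'm, 'p) doctrine \<Rightarrow> 'o \<Rightarrow> 'p \<Rightarrow> bool" where
  "existential_splitting P A \<alpha> \<longleftrightarrow> A \<in> Obj P \<and> \<alpha> \<in> pred P A \<and>
    (\<forall>B X p q \<beta>. is_product P A B X p q \<and> \<beta> \<in> pred P X \<and> \<alpha> \<sqsubseteq>\<^bsub>fibre P A\<^esub> ex_along P p \<beta> \<longrightarrow>
      (\<exists>g \<in> homset P A B. \<alpha> \<sqsubseteq>\<^bsub>fibre P A\<^esub> reindex P (pairing P p q (Idn P A) g) \<beta>))"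

definition existential_free :: "('o, 'm, 'p) doctrine \<Rightarrow> 'o \<Rightarrow> 'p \<Rightarrow> bool" where
  "existential_free P I \<alpha> \<longleftrightarrow> I \<in> Obj P \<and> \<alpha> \<in> pred P I \<and>
    (\<forall>A. \<forall>f \<in> homset P A I. existential_splitting P A (reindex P f \<alpha>))"

definition enough_existential_free :: "('o, 'm, 'p) doctrine \<Rightarrow> bool" where
  "enough_existential_free P \<longleftrightarrow> (\<forall>I \<in> Obj P. \<forall>\<alpha> \<in> pred P I.
    \<exists>A X p q \<beta>. is_product P I A X p q \<and> existential_free P X \<beta> \<and> \<alpha> = ex_along P p \<beta>)"

definition universal_splitting :: "('o, 'm, 'p) doctrine \<Rightarrow> 'o \<Rightarrow> 'p \<Rightarrow> bool" where
  "universal_splitting P A \<alpha> \<longleftrightarrow> A \<in> Obj P \<and> \<alpha> \<in> pred P A \<and>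
    (\<forall>B X p q \<beta>. is_product P A B X p q \<and> \<beta> \<in> pred P X \<and> all_along P p \<beta> \<sqsubseteq>\<^bsub>fibre P A\<^esub> \<alpha> \<longrightarrow>
      (\<exists>g \<in> homset P A B. reindex P (pairing P p q (Idn P A) g) \<beta> \<sqsubseteq>\<^bsub>fibre P A\<^esub> \<alpha>))"

definition universal_free :: "('o, 'm, 'p) doctrine \<Rightarrow> 'o \<Rightarrow> 'p \<Rightarrow> bool" where
  "universal_free P I \<alpha> \<longleftrightarrow> I \<in> Obj P \<and> \<alpha> \<in> pred P I \<and>
    (\<forall>A. \<forall>f \<in> homset P A I. universal_splitting P A (reindex P f \<alpha>))"

definition enough_universal_free :: "('o, 'm, 'p) doctrine \<Rightarrow> bool" where
  "enough_universal_free P \<longleftrightarrow> (\<forall>I \<in> Obj P. \<forall>\<alpha> \<in> pred P I.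
    \<exists>A X p q \<beta>. is_product P I A X p q \<and> universal_free P X \<beta> \<and> \<alpha> = all_along P p \<beta>)"

definition exfree_subdoctrine :: "('o, 'm, 'p) doctrine \<Rightarrow> ('o, 'm, 'p) doctrine" where
  "exfree_subdoctrine P =
    P\<lparr>fibre := \<lambda>A. (fibre P A)\<lparr>carrier := {\<alpha>. existential_free P A \<alpha>}\<rparr>\<rparr>"


section \<open>Skolem and Goedel doctrines, hyperdoctrines\<close>

locale skolem_doctrine =
  cartesian_closed_category P + existential_doctrine P + universal_doctrine P
  for P :: "('o, 'm, 'p) doctrine" (structure) +
  assumes enough_exfree: "enough_existential_free P"
    and all_exfree: "is_projection P p \<Longrightarrow> existential_free P (Dom P p) \<alpha> \<Longrightarrow>
      existential_free P (Cod P p) (all_along P p \<alpha>)"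

locale goedel_doctrine = skolem_doctrine P for P :: "('o, 'm, 'p) doctrine" (structure) +
  assumes enough_unfree: "enough_universal_free (exfree_subdoctrine P)"

definition quantifier_free :: "('o, 'm, 'p) doctrine \<Rightarrow> 'o \<Rightarrow> 'p \<Rightarrow> bool" where
  "quantifier_free P A \<alpha> \<longleftrightarrow>
    existential_free P A \<alpha> \<and> universal_free (exfree_subdoctrine P) A \<alpha>"

locale first_order_hyperdoctrine =
  doctrine P for P :: "('o, 'm, 'p) doctrine" (structure) +
  assumes fibre_heyting: "A \<in> Obj P \<Longrightarrow> heyting_algebra (fibre P A)"
    and reindex_heyting: "f \<in> homset P A B \<Longrightarrow> heyting_hom (fibre P B) (fibre P A) (reindex P f)"
    and ex_adjoint_arr: "f \<in> Arr P \<Longrightarrow> has_ex_along P f"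
    and all_adjoint_arr: "f \<in> Arr P \<Longrightarrow> has_all_along P f"
    and ex_bc_arr: "is_pullback P f g h k \<Longrightarrow> ex_beck_chevalley P f g h k"
    and all_bc_arr: "is_pullback P f g h k \<Longrightarrow> all_beck_chevalley P f g h k"

locale goedel_hyperdoctrine = first_order_hyperdoctrine P + goedel_doctrine P
  for P :: "('o, 'm, 'p) doctrine" (structure)


section \<open>The encodings above are well defined\<close>

lemma himp_eq:
  assumes "partial_order L" "greatest L z {w \<in> carrier L. w \<sqinter>\<^bsub>L\<^esub> x \<sqsubseteq>\<^bsub>L\<^esub> y}"
  shows "himp L x y = z"
  unfolding himp_def using assms by (blast intro: the_equality partial_order.greatest_unique)

lemma ex_along_eq:
  assumes e: "galois_connection
      \<lparr>orderA = fibre P (Dom P f), orderB = fibre P (Cod P f), lower = e, upper = reindex P f\<rparr>"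
    and b: "\<beta> \<in> pred P (Dom P f)"
  shows "ex_along P f \<beta> = e \<beta>"
proof -
  let ?G = "\<lambda>e. \<lparr>orderA = fibre P (Dom P f), orderB = fibre P (Cod P f), lower = e,
    upper = reindex P f\<rparr>"
  have s: "galois_connection (?G (ex_along P f))"
    unfolding ex_along_def by (rule someI[where P = "\<lambda>e. galois_connection (?G e)", OF e])
  interpret po: partial_order "fibre P (Cod P f)"
    using e by (simp add: galois_connection_def connection_def)
  have c: "e \<beta> \<in> pred P (Cod P f)" "ex_along P f \<beta> \<in> pred P (Cod P f)"
    using e s b by (auto simp: galois_connection_def connection_def)
  show ?thesis
    using galois_connection.galois_property[OF e] galois_connection.galois_property[OF s] b c
    by (intro po.le_antisym) (simp_all, (meson po.le_refl)+)
qed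

lemma all_along_eq:
  assumes u: "galois_connection
      \<lparr>orderA = fibre P (Cod P f), orderB = fibre P (Dom P f), lower = reindex P f, upper = u\<rparr>"
    and b: "\<beta> \<in> pred P (Dom P f)"
  shows "all_along P f \<beta> = u \<beta>"
proof -
  let ?G = "\<lambda>u. \<lparr>orderA = fibre P (Cod P f), orderB = fibre P (Dom P f), lower = reindex P f,
    upper = u\<rparr>"
  have s: "galois_connection (?G (all_along P f))"
    unfolding all_along_def by (rule someI[where P = "\<lambda>u. galois_connection (?G u)", OF u])
  interpret po: partial_order "fibre P (Cod P f)"
    using u by (simp add: galois_connection_def connection_def)
  have c: "u \<beta> \<in> pred P (Cod P f)" "all_along P f \<beta> \<in> pred P (Cod P f)"
    using u s b by (auto simp: galois_connection_def connection_def)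
  show ?thesis
    using galois_connection.galois_property[OF u] galois_connection.galois_property[OF s] b c
    by (intro po.le_antisym) (simp_all, (meson po.le_refl)+)
qed

lemma exfree_subdoctrine_simps [simp]:
  "Obj (exfree_subdoctrine P) = Obj P"
  "Arr (exfree_subdoctrine P) = Arr P"
  "Dom (exfree_subdoctrine P) = Dom P"
  "Cod (exfree_subdoctrine P) = Cod P"
  "Idn (exfree_subdoctrine P) = Idn P"
  "Comp (exfree_subdoctrine P) = Comp P"
  "reindex (exfree_subdoctrine P) = reindex P"
  "pred (exfree_subdoctrine P) A = {\<alpha>. existential_free P A \<alpha>}"
  "le (fibre (exfree_subdoctrine P) A) = le (fibre P A)"
  "eq (fibre (exfree_subdoctrine P) A) = eq (fibre P A)"
  by (simp_all add: exfree_subdoctrine_def)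

lemma exfree_subdoctrine_base [simp]:
  "homset (exfree_subdoctrine P) = homset P"
  "is_terminal (exfree_subdoctrine P) = is_terminal P"
  "is_product (exfree_subdoctrine P) = is_product P"
  "is_projection (exfree_subdoctrine P) = is_projection P"
  "pairing (exfree_subdoctrine P) = pairing P"
  "is_pullback (exfree_subdoctrine P) = is_pullback P"
proof -
  show h: "homset (exfree_subdoctrine P) = homset P"
    by (intro ext) (simp add: homset_def)
  show "is_terminal (exfree_subdoctrine P) = is_terminal P"
    by (intro ext) (simp add: is_terminal_def h)
  show p: "is_product (exfree_subdoctrine P) = is_product P"
    by (intro ext) (simp add: is_product_def h)
  show "is_projection (exfree_subdoctrine P) = is_projection P"
    by (intro ext) (simp add: is_projection_def p)
  show "pairing (exfree_subdoctrine P) = pairing P"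
    by (intro ext) (simp add: pairing_def h)
  show "is_pullback (exfree_subdoctrine P) = is_pullback P"
    by (intro ext) (simp add: is_pullback_def h)
qed

context doctrine
begin

lemma existential_free_reindex:
  assumes f: "f \<in> homset P A B" and a: "existential_free P B \<alpha>"
  shows "existential_free P A (reindex P f \<alpha>)"
  unfolding existential_free_def
proof (intro conjI allI ballI)
  have B: "\<alpha> \<in> pred P B" using a by (simp add: existential_free_def)
  show "A \<in> Obj P" using f dom_obj by (auto simp: homset_def)
  show "reindex P f \<alpha> \<in> pred P A" using reindex_closed[OF f] B by blast
  fix D g assume g: "g \<in> homset P D A"
  have "existential_splitting P D (reindex P (f \<odot> g) \<alpha>)"
    using a comp_hom[OF g f] by (simp add: existential_free_def)
  then show "existential_splitting P D (reindex P g (reindex P f \<alpha>))"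
    using reindex_comp[OF g f B] by simp
qed

lemma exfree_subdoctrine_doctrine: "doctrine (exfree_subdoctrine P)"
proof (intro doctrine.intro doctrine_axioms.intro finite_product_category.intro
    finite_product_category_axioms.intro category.intro)
  let ?Q = "exfree_subdoctrine P"
  have sub: "existential_free P A \<alpha> \<Longrightarrow> \<alpha> \<in> pred P A" for A \<alpha>
    by (simp add: existential_free_def)
  show ord: "partial_order (fibre ?Q A)" if "A \<in> Obj ?Q" for A
  proof -
    interpret po: partial_order "fibre P A" using that fibre_order by simp
    show ?thesis
      using po.eq_is_equal by unfold_locales (auto dest!: sub intro: po.le_trans po.le_antisym)
  qed
  show "isotone (fibre ?Q B) (fibre ?Q A) (reindex ?Q f)" if "f \<in> homset ?Q A B" for f A B
  proof -
    have "A \<in> Obj ?Q" "B \<in> Obj ?Q"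
      using that dom_obj cod_obj by (auto simp: homset_def)
    then have "weak_partial_order (fibre ?Q A)" "weak_partial_order (fibre ?Q B)"
      using ord partial_order.axioms(1) by blast+
    then show ?thesis
      using reindex_mono[of f A B] that by (auto simp: isotone_def dest!: sub)
  qed
next
  fix f A B assume "f \<in> homset (exfree_subdoctrine P) A B"
  then show "reindex (exfree_subdoctrine P) f
      \<in> pred (exfree_subdoctrine P) B \<rightarrow> pred (exfree_subdoctrine P) A"
    using existential_free_reindex by auto
qed (simp_all add: dom_obj cod_obj idn_hom comp_hom comp_idn_right comp_idn_left comp_assoc
    has_terminal has_products reindex_idn reindex_comp existential_free_def[of P])

end

context skolem_doctrine
begin

lemma exfree_all_galois:
  assumes p: "is_projection P p"
  defines "Q \<equiv> exfree_subdoctrine P"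
  shows "galois_connection \<lparr>orderA = fibre Q (Cod P p), orderB = fibre Q (Dom P p),
    lower = reindex P p, upper = all_along P p\<rparr>"
proof -
  interpret Q: doctrine Q unfolding Q_def by (rule exfree_subdoctrine_doctrine)
  have ph: "p \<in> homset P (Dom P p) (Cod P p)" "Dom P p \<in> Obj P" "Cod P p \<in> Obj P"
    using p dom_obj cod_obj by (auto simp: is_projection_def is_product_def homset_def)
  obtain u where u: "galois_connection \<lparr>orderA = fibre P (Cod P p), orderB = fibre P (Dom P p),
    lower = reindex P p, upper = u\<rparr>"
    using all_adjoint[OF p] by (auto simp: has_all_along_def lower_adjoint_def)
  show ?thesis
    using ph Q.fibre_order existential_free_reindex[OF ph(1)] all_exfree[OF p]
      galois_connection.galois_property[OF u] all_along_eq[OF u]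
    by (auto simp: galois_connection_def galois_connection_axioms_def connection_def Q_def
        existential_free_def[of P])
qed

lemma exfree_all_along:
  assumes "is_projection P p" "existential_free P (Dom P p) \<alpha>"
  shows "all_along (exfree_subdoctrine P) p \<alpha> = all_along P p \<alpha>"
  using all_along_eq[of "exfree_subdoctrine P" p "all_along P p" \<alpha>]
    exfree_all_galois[OF assms(1)] assms(2) by simp

lemma exfree_subdoctrine_universal: "universal_doctrine (exfree_subdoctrine P)"
proof -
  interpret Q: doctrine "exfree_subdoctrine P" by (rule exfree_subdoctrine_doctrine)
  show ?thesis
  proof unfold_locales
    fix p assume "is_projection (exfree_subdoctrine P) p"
    then show "has_all_along (exfree_subdoctrine P) p"
      using exfree_all_galois[of p] by (auto simp: has_all_along_def lower_adjoint_def)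
  next
    fix p f f' p'
    assume pb: "is_pullback (exfree_subdoctrine P) p f f' p'"
      and p: "is_projection (exfree_subdoctrine P) p"
      and p': "is_projection (exfree_subdoctrine P) p'"
    have f': "f' \<in> homset P (Dom P p') (Dom P p)"
      using pb by (auto simp: is_pullback_def homset_def)
    show "all_beck_chevalley (exfree_subdoctrine P) p f f' p'"
      unfolding all_beck_chevalley_def
      using all_bc[of p f f' p'] pb p p' existential_free_reindex[OF f']
      by (auto simp: all_beck_chevalley_def exfree_all_along existential_free_def[of P "Dom P p"])
  qed
qed

end

end

theory Submission
  imports Defs
begin

text \<open>Write \<open>\<gamma> = \<not>\<forall>a. \<alpha>\<close>. Two consequences of the hypotheses on \<open>\<bottom>\<close> drive the proof. As \<open>\<bottom>\<close>
  is existential-free, every product projection has a section. As it is universal-free, a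
  refutation \<open>\<forall>a. \<epsilon>(a,b) \<turnstile> \<bottom>\<close> of an existential-free \<open>\<epsilon>\<close> is witnessed by a term,
  \<open>\<epsilon>(g(b),b) \<turnstile> \<bottom>\<close>.

  Existential-free predicates need not be closed under conjunction, but \<open>\<not>(\<gamma> \<rightarrow> \<not>\<beta>)\<close>, the double
  negation of \<open>\<gamma> \<and> \<beta>\<close>, is again existential-free. Hence, for regular \<open>\<gamma>\<close>, from
  \<open>\<gamma> \<and> \<forall>a. \<not>\<beta> \<turnstile> \<bottom>\<close> one gets a term \<open>g\<close> with \<open>\<gamma> \<turnstile> \<not>\<not>\<beta>(g(b),b)\<close>. With \<open>\<beta> = \<not>\<alpha>\<close> this would
  finish the proof, were \<open>\<alpha>\<close> replaced by \<open>\<not>\<not>\<alpha>\<close> in \<open>\<gamma>\<close>. The missing step is the double negation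
  shift \<open>\<not>\<forall>a. \<alpha> \<turnstile> \<not>\<forall>a. \<not>\<not>\<alpha>\<close>: if \<open>\<gamma>\<close> is regular with \<open>\<gamma> \<turnstile> \<forall>a. \<not>\<not>\<alpha>\<close> and
  \<open>\<gamma> \<and> \<forall>a. \<alpha> \<turnstile> \<bottom>\<close>, write \<open>\<gamma> \<and> \<alpha> = \<exists>x. \<delta>(x,a,b)\<close> with \<open>\<delta>\<close> existential-free. The previous
  step yields \<open>f\<close> with \<open>\<gamma> \<turnstile> \<not>\<not>\<delta>(f(a,b),a,b)\<close>, whereas \<open>\<forall>a. \<delta>(f(a,b),a,b) \<turnstile> \<bottom>\<close> is refuted by
  some term \<open>a = g(b)\<close>, so that \<open>\<gamma> \<turnstile> \<bottom>\<close>.\<close>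

section \<open>Implication, negation and regular elements in Heyting algebras\<close>

context heyting_algebra
begin

lemma himp_greatest:
  assumes "x \<in> carrier L" "y \<in> carrier L"
  shows "greatest L (himp L x y) {w \<in> carrier L. w \<sqinter> x \<sqsubseteq> y}"
  using imp_exists[OF assms] himp_eq[OF partial_order_axioms] by metis

lemma himp_closed [simp]: "x \<in> carrier L \<Longrightarrow> y \<in> carrier L \<Longrightarrow> himp L x y \<in> carrier L"
  using himp_greatest by (fastforce simp: greatest_def)

lemma meet_mono:
  assumes "x \<sqsubseteq> x'" "y \<sqsubseteq> y'" "x \<in> carrier L" "x' \<in> carrier L" "y \<in> carrier L" "y' \<in> carrier L"
  shows "x \<sqinter> y \<sqsubseteq> x' \<sqinter> y'"
  using assms by (meson le_trans meet_closed meet_le meet_left meet_right)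

lemma le_himp_iff:
  assumes x: "x \<in> carrier L" and y: "y \<in> carrier L" and w: "w \<in> carrier L"
  shows "w \<sqsubseteq> himp L x y \<longleftrightarrow> w \<sqinter> x \<sqsubseteq> y"
proof
  have g: "himp L x y \<sqinter> x \<sqsubseteq> y"
    using himp_greatest[OF x y] by (auto simp: greatest_def)
  assume "w \<sqsubseteq> himp L x y"
  then have "w \<sqinter> x \<sqsubseteq> himp L x y \<sqinter> x"
    using assms by (intro meet_mono) auto
  then show "w \<sqinter> x \<sqsubseteq> y"
    using g assms by (meson le_trans meet_closed himp_closed)
next
  assume "w \<sqinter> x \<sqsubseteq> y"
  then show "w \<sqsubseteq> himp L x y"
    using himp_greatest[OF x y] w by (auto simp: greatest_def Upper_def)
qed

lemma hneg_closed [simp]: "x \<in> carrier L \<Longrightarrow> hneg L x \<in> carrier L"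
  by (simp add: hneg_def)

lemma le_hneg_iff:
  "x \<in> carrier L \<Longrightarrow> y \<in> carrier L \<Longrightarrow> x \<sqsubseteq> hneg L y \<longleftrightarrow> x \<sqinter> y \<sqsubseteq> \<bottom>"
  by (simp add: hneg_def le_himp_iff)

lemma le_hneg_commute:
  "x \<in> carrier L \<Longrightarrow> y \<in> carrier L \<Longrightarrow> x \<sqsubseteq> hneg L y \<longleftrightarrow> y \<sqsubseteq> hneg L x"
  by (simp add: le_hneg_iff meet_comm)

lemma le_hneg_hneg: "x \<in> carrier L \<Longrightarrow> x \<sqsubseteq> hneg L (hneg L x)"
  by (simp add: le_hneg_commute[of x])

lemma hneg_antimono:
  "x \<sqsubseteq> y \<Longrightarrow> x \<in> carrier L \<Longrightarrow> y \<in> carrier L \<Longrightarrow> hneg L y \<sqsubseteq> hneg L x"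
  by (meson hneg_closed le_hneg_commute le_hneg_hneg le_trans)

text \<open>Holds because z lies below \<open>himp L x z\<close>. For \<open>z = hneg L y\<close>
  the left side is the double negation of the meet of x and y; the bounds here and in the next two
  lemmas let it stand in for that meet.\<close>

lemma hneg_himp_le_hneg:
  assumes "x \<in> carrier L" "z \<in> carrier L"
  shows "hneg L (himp L x z) \<sqsubseteq> hneg L z"
  using assms by (intro hneg_antimono) (auto simp: le_himp_iff meet_left)

text \<open>Ex falso puts \<open>hneg L x\<close> below the implication, so the negated implication
  lies below the double negation of x; regularity of x then removes the double negation.\<close>

lemma hneg_himp_le:
  assumes r: "hneg L (hneg L x) \<sqsubseteq> x" and "x \<in> carrier L" "z \<in> carrier L"
  shows "hneg L (himp L x z) \<sqsubseteq> x"
proof -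
  have "hneg L x \<sqinter> x \<sqsubseteq> z"
    using assms le_hneg_iff[of "hneg L x" x]
    by (meson bottom_closed bottom_lower hneg_closed le_refl le_trans meet_closed)
  then have "hneg L (himp L x z) \<sqsubseteq> hneg L (hneg L x)"
    using assms by (intro hneg_antimono) (auto simp: le_himp_iff)
  with r show ?thesis
    using assms by (meson hneg_closed himp_closed le_trans)
qed

text \<open>By modus ponens the implication is disjoint from the meet of x and y.\<close>

lemma meet_le_hneg_himp_hneg:
  assumes "x \<in> carrier L" "y \<in> carrier L"
  shows "x \<sqinter> y \<sqsubseteq> hneg L (himp L x (hneg L y))"
proof -
  let ?i = "himp L x (hneg L y)"
  have c: "?i \<in> carrier L" using assms by simp
  have "?i \<sqinter> x \<sqsubseteq> hneg L y"
    using assms c le_himp_iff[of x "hneg L y" ?i] by simp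
  then have "?i \<sqinter> x \<sqinter> y \<sqsubseteq> \<bottom>"
    using assms c by (simp add: le_hneg_iff)
  then have "?i \<sqsubseteq> hneg L (x \<sqinter> y)"
    using assms c by (simp add: le_hneg_iff meet_assoc)
  then show ?thesis
    using assms c by (simp add: le_hneg_commute)
qed

end

section \<open>Reindexing and the quantifier adjunctions\<close>

context first_order_hyperdoctrine
begin

lemma reindex_pred: "f \<in> homset P A B \<Longrightarrow> \<beta> \<in> pred P B \<Longrightarrow> reindex P f \<beta> \<in> pred P A"
  using reindex_closed by blast

lemma reindex_le:
  "f \<in> homset P A B \<Longrightarrow> \<beta> \<sqsubseteq>\<^bsub>fibre P B\<^esub> \<gamma> \<Longrightarrow> \<beta> \<in> pred P B \<Longrightarrow> \<gamma> \<in> pred P B \<Longrightarrow>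
    reindex P f \<beta> \<sqsubseteq>\<^bsub>fibre P A\<^esub> reindex P f \<gamma>"
  using reindex_mono by (blast intro: use_iso2)

lemma reindex_bot: "f \<in> homset P A B \<Longrightarrow> reindex P f \<bottom>\<^bsub>fibre P B\<^esub> = \<bottom>\<^bsub>fibre P A\<^esub>"
  using reindex_heyting by (auto simp: heyting_hom_def)

lemma reindex_himp:
  "f \<in> homset P A B \<Longrightarrow> \<beta> \<in> pred P B \<Longrightarrow> \<gamma> \<in> pred P B \<Longrightarrow>
    reindex P f (himp (fibre P B) \<beta> \<gamma>) = himp (fibre P A) (reindex P f \<beta>) (reindex P f \<gamma>)"
  using reindex_heyting by (auto simp: heyting_hom_def)

lemma reindex_hneg:
  assumes f: "f \<in> homset P A B" and b: "\<beta> \<in> pred P B"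
  shows "reindex P f (hneg (fibre P B) \<beta>) = hneg (fibre P A) (reindex P f \<beta>)"
proof -
  have "B \<in> Obj P" using f cod_obj by (auto simp: homset_def)
  then interpret B: heyting_algebra "fibre P B" by (rule fibre_heyting)
  show ?thesis
    unfolding hneg_def by (simp add: reindex_himp[OF f b] reindex_bot[OF f])
qed

text \<open>As \<open>all_along\<close> is an arbitrary choice, the adjunction is first obtained for
  some right adjoint u and then carried over by \<open>all_along_eq\<close>.\<close>

lemma
  assumes p: "p \<in> homset P X A" and b: "\<beta> \<in> pred P X"
  shows all_closed: "all_along P p \<beta> \<in> pred P A"
    and le_all_iff: "\<gamma> \<in> pred P A \<Longrightarrow>
      \<gamma> \<sqsubseteq>\<^bsub>fibre P A\<^esub> all_along P p \<beta> \<longleftrightarrow> reindex P p \<gamma> \<sqsubseteq>\<^bsub>fibre P X\<^esub> \<beta>"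
proof -
  have p': "p \<in> Arr P" "Dom P p = X" "Cod P p = A" using p by (auto simp: homset_def)
  obtain u where u: "galois_connection \<lparr>orderA = fibre P (Cod P p), orderB = fibre P (Dom P p),
    lower = reindex P p, upper = u\<rparr>"
    using all_adjoint_arr[OF p'(1)] by (auto simp: has_all_along_def lower_adjoint_def)
  have e: "all_along P p \<beta> = u \<beta>" using all_along_eq[OF u] b p' by simp
  show "all_along P p \<beta> \<in> pred P A"
    using u b p' e by (auto simp: galois_connection_def connection_def)
  show "\<gamma> \<sqsubseteq>\<^bsub>fibre P A\<^esub> all_along P p \<beta> \<longleftrightarrow> reindex P p \<gamma> \<sqsubseteq>\<^bsub>fibre P X\<^esub> \<beta>"
    if "\<gamma> \<in> pred P A"
    using galois_connection.galois_property[OF u] that b p' e by simp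
qed

lemma
  assumes p: "p \<in> homset P X A" and b: "\<beta> \<in> pred P X"
  shows ex_closed: "ex_along P p \<beta> \<in> pred P A"
    and ex_le_iff: "\<gamma> \<in> pred P A \<Longrightarrow>
      ex_along P p \<beta> \<sqsubseteq>\<^bsub>fibre P A\<^esub> \<gamma> \<longleftrightarrow> \<beta> \<sqsubseteq>\<^bsub>fibre P X\<^esub> reindex P p \<gamma>"
proof -
  have p': "p \<in> Arr P" "Dom P p = X" "Cod P p = A" using p by (auto simp: homset_def)
  obtain e where e: "galois_connection \<lparr>orderA = fibre P (Dom P p), orderB = fibre P (Cod P p),
    lower = e, upper = reindex P p\<rparr>"
    using ex_adjoint_arr[OF p'(1)] by (auto simp: has_ex_along_def upper_adjoint_def)
  have eq: "ex_along P p \<beta> = e \<beta>" using ex_along_eq[OF e] b p' by simp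
  show "ex_along P p \<beta> \<in> pred P A"
    using e b p' eq by (auto simp: galois_connection_def connection_def)
  show "ex_along P p \<beta> \<sqsubseteq>\<^bsub>fibre P A\<^esub> \<gamma> \<longleftrightarrow> \<beta> \<sqsubseteq>\<^bsub>fibre P X\<^esub> reindex P p \<gamma>"
    if "\<gamma> \<in> pred P A"
    using galois_connection.galois_property[OF e] that b p' eq by simp
qed

lemma reindex_all_le:
  assumes p: "p \<in> homset P X A" and b: "\<beta> \<in> pred P X"
  shows "reindex P p (all_along P p \<beta>) \<sqsubseteq>\<^bsub>fibre P X\<^esub> \<beta>"
proof -
  have "A \<in> Obj P" using p cod_obj by (auto simp: homset_def)
  then interpret A: heyting_algebra "fibre P A" by (rule fibre_heyting)
  show ?thesis
    using le_all_iff[OF p b] all_closed[OF p b] by blast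
qed

lemma le_reindex_ex:
  assumes p: "p \<in> homset P X A" and b: "\<beta> \<in> pred P X"
  shows "\<beta> \<sqsubseteq>\<^bsub>fibre P X\<^esub> reindex P p (ex_along P p \<beta>)"
proof -
  have "A \<in> Obj P" using p cod_obj by (auto simp: homset_def)
  then interpret A: heyting_algebra "fibre P A" by (rule fibre_heyting)
  show ?thesis
    using ex_le_iff[OF p b] ex_closed[OF p b] by blast
qed

lemma all_mono:
  assumes p: "p \<in> homset P X A" and "\<beta> \<sqsubseteq>\<^bsub>fibre P X\<^esub> \<gamma>" "\<beta> \<in> pred P X" "\<gamma> \<in> pred P X"
  shows "all_along P p \<beta> \<sqsubseteq>\<^bsub>fibre P A\<^esub> all_along P p \<gamma>"
proof -
  have "X \<in> Obj P" using p dom_obj by (auto simp: homset_def)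
  then interpret X: heyting_algebra "fibre P X" by (rule fibre_heyting)
  show ?thesis
    using assms reindex_all_le[OF p assms(3)] reindex_pred[OF p] all_closed[OF p]
    by (auto simp: le_all_iff intro: X.le_trans)
qed

lemma reindex_section:
  assumes "h \<in> homset P A X" "p \<in> homset P X A" "p \<odot> h = Idn P A" "\<gamma> \<in> pred P A"
  shows "reindex P h (reindex P p \<gamma>) = \<gamma>"
proof -
  have "A \<in> Obj P" using assms(1) dom_obj by (auto simp: homset_def)
  then show ?thesis
    using reindex_comp[OF assms(1,2,4)] assms(3,4) reindex_idn by simp
qed

text \<open>A universal quantifier over an empty type would be vacuous. The section rules this out:
  reindexing along h cancels the reindexing along p on both sides.\<close>

lemma all_le_section:
  assumes h: "h \<in> homset P A X" "p \<odot> h = Idn P A" and p: "p \<in> homset P X A"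
    and b: "\<beta> \<in> pred P X" and c: "\<gamma> \<in> pred P A"
    and le: "\<beta> \<sqsubseteq>\<^bsub>fibre P X\<^esub> reindex P p \<gamma>"
  shows "all_along P p \<beta> \<sqsubseteq>\<^bsub>fibre P A\<^esub> \<gamma>"
proof -
  have "X \<in> Obj P" using p dom_obj by (auto simp: homset_def)
  then interpret X: heyting_algebra "fibre P X" by (rule fibre_heyting)
  note a = all_closed[OF p b]
  have "reindex P p (all_along P p \<beta>) \<sqsubseteq>\<^bsub>fibre P X\<^esub> reindex P p \<gamma>"
    using le reindex_all_le[OF p b] reindex_pred[OF p] a b c by (meson X.le_trans)
  then have "reindex P h (reindex P p (all_along P p \<beta>))
      \<sqsubseteq>\<^bsub>fibre P A\<^esub> reindex P h (reindex P p \<gamma>)"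
    using reindex_pred[OF p] a c by (intro reindex_le[OF h(1)]) auto
  then show ?thesis
    using reindex_section[OF h(1) p h(2)] a c by simp
qed

text \<open>Reindexing commutes with negation, and the double negation of anything below
  \<open>\<not>\<not>\<beta>\<close> stays below it. So the counit of the adjunction survives double
  negation of \<phi> and can be transposed back.\<close>

lemma all_hneg_hneg_regular:
  assumes p: "p \<in> homset P X A" and b: "\<beta> \<in> pred P X"
  defines "\<phi> \<equiv> all_along P p (hneg (fibre P X) (hneg (fibre P X) \<beta>))"
  shows "hneg (fibre P A) (hneg (fibre P A) \<phi>) \<sqsubseteq>\<^bsub>fibre P A\<^esub> \<phi>"
proof -
  have o: "A \<in> Obj P" "X \<in> Obj P" using p dom_obj cod_obj by (auto simp: homset_def)
  interpret A: heyting_algebra "fibre P A" using o(1) by (rule fibre_heyting)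
  interpret X: heyting_algebra "fibre P X" using o(2) by (rule fibre_heyting)
  let ?nX = "hneg (fibre P X)"
  have ph: "\<phi> \<in> pred P A" unfolding \<phi>_def using b by (intro all_closed[OF p]) simp
  have r: "reindex P p \<phi> \<in> pred P X" using reindex_pred[OF p ph] .
  have "reindex P p \<phi> \<sqsubseteq>\<^bsub>fibre P X\<^esub> ?nX (?nX \<beta>)"
    unfolding \<phi>_def using b by (intro reindex_all_le[OF p]) simp
  then have "?nX \<beta> \<sqsubseteq>\<^bsub>fibre P X\<^esub> ?nX (reindex P p \<phi>)"
    using b r X.le_hneg_commute[of "reindex P p \<phi>" "?nX \<beta>"] by simp
  then have "?nX (?nX (reindex P p \<phi>)) \<sqsubseteq>\<^bsub>fibre P X\<^esub> ?nX (?nX \<beta>)"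
    using b r by (rule X.hneg_antimono[OF _ X.hneg_closed X.hneg_closed])
  then have "reindex P p (hneg (fibre P A) (hneg (fibre P A) \<phi>)) \<sqsubseteq>\<^bsub>fibre P X\<^esub> ?nX (?nX \<beta>)"
    using ph by (simp add: reindex_hneg[OF p])
  then show ?thesis
    unfolding \<phi>_def using b ph[unfolded \<phi>_def] by (subst le_all_iff[OF p]) auto
qed

end

section \<open>Terms as sections of product projections\<close>

context category
begin

lemma pairing_section:
  assumes X: "is_product C A B X p q" and g: "g \<in> homset C A B" and A: "A \<in> Obj C"
  shows "pairing C p q (Idn C A) g \<in> homset C A X" "p \<odot> pairing C p q (Idn C A) g = Idn C A"
proof -
  have d: "Dom C (Idn C A) = A" "Dom C p = X"
    using X idn_hom[OF A] by (auto simp: is_product_def homset_def)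
  have "\<exists>!h. h \<in> homset C A X \<and> p \<odot> h = Idn C A \<and> q \<odot> h = g"
    using X g A idn_hom[OF A] by (auto simp: is_product_def)
  from theI'[OF this] show "pairing C p q (Idn C A) g \<in> homset C A X"
    "p \<odot> pairing C p q (Idn C A) g = Idn C A"
    by (simp_all add: pairing_def d)
qed

end

lemma is_product_commute: "is_product C A B X p q \<Longrightarrow> is_product C B A X q p"
  by (auto simp: is_product_def conj_commute conj_left_commute)

section \<open>Witness extraction, double negation shift and Markov's principle\<close>

locale implicative_goedel_hyperdoctrine = goedel_hyperdoctrine P
  for P :: "('o, 'm, 'p) doctrine" (structure) +
  assumes exfree_himp: "existential_free P A \<alpha> \<Longrightarrow> existential_free P A \<beta> \<Longrightarrow>
      existential_free P A (himp (fibre P A) \<alpha> \<beta>)"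
    and quantifier_free_bot: "A \<in> Obj P \<Longrightarrow> quantifier_free P A \<bottom>\<^bsub>fibre P A\<^esub>"
begin

lemma exfree_pred: "existential_free P A \<alpha> \<Longrightarrow> \<alpha> \<in> pred P A"
  by (simp add: existential_free_def)

lemma exfree_hneg: "existential_free P A \<alpha> \<Longrightarrow> existential_free P A (hneg (fibre P A) \<alpha>)"
  using quantifier_free_bot[of A]
  by (auto simp: hneg_def quantifier_free_def existential_free_def[of P A \<alpha>] intro: exfree_himp)

text \<open>Splitting is applied to the trivial entailment from \<bottom> to \<exists>b. \<bottom>.
  The entailment it returns carries no information; what matters is that it supplies a term
  \<open>g\<close> from A to B at all.\<close>

lemma product_section:
  assumes X: "is_product P A B X p q"
  obtains h where "h \<in> homset P A X" "p \<odot> h = Idn P A"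
proof -
  have p: "p \<in> homset P X A" using X by (simp add: is_product_def)
  have o: "A \<in> Obj P" "X \<in> Obj P" using p dom_obj cod_obj by (auto simp: homset_def)
  interpret A: heyting_algebra "fibre P A" using o(1) by (rule fibre_heyting)
  interpret X: heyting_algebra "fibre P X" using o(2) by (rule fibre_heyting)
  have "existential_splitting P A (reindex P (Idn P A) \<bottom>\<^bsub>fibre P A\<^esub>)"
    using quantifier_free_bot[OF o(1)] idn_hom[OF o(1)]
    by (simp add: quantifier_free_def existential_free_def)
  then have "existential_splitting P A \<bottom>\<^bsub>fibre P A\<^esub>"
    by (simp add: reindex_idn o)
  then obtain g where "g \<in> homset P A B"
    using X A.bottom_lower[OF ex_closed[OF p X.bottom_closed]]
    unfolding existential_splitting_def by blast
  then show ?thesis using that pairing_section[OF X _ o(1)] by blast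
qed

text \<open>This is universal splitting of \<bottom>. It is available in the subdoctrine of
  existential-free predicates, whence the condition on \<beta>.\<close>

lemma all_le_bot_witness:
  assumes X: "is_product P A B X p q" and b: "existential_free P X \<beta>"
    and le: "all_along P p \<beta> \<sqsubseteq>\<^bsub>fibre P A\<^esub> \<bottom>\<^bsub>fibre P A\<^esub>"
  obtains h where "h \<in> homset P A X" "p \<odot> h = Idn P A"
    "reindex P h \<beta> \<sqsubseteq>\<^bsub>fibre P A\<^esub> \<bottom>\<^bsub>fibre P A\<^esub>"
proof -
  have p: "p \<in> homset P X A" "is_projection P p"
    using X by (auto simp: is_product_def is_projection_def)
  have A: "A \<in> Obj P" using p cod_obj by (auto simp: homset_def)
  interpret A: heyting_algebra "fibre P A" using A by (rule fibre_heyting)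
  \<comment> \<open>Splitting there refers to the quantifier of the subdoctrine, which on \<beta>
    agrees with that of P.\<close>
  have e: "all_along (exfree_subdoctrine P) p \<beta> = all_along P p \<beta>"
    using exfree_all_along[OF p(2)] b p(1) by (simp add: homset_def)
  have "universal_splitting (exfree_subdoctrine P) A (reindex P (Idn P A) \<bottom>\<^bsub>fibre P A\<^esub>)"
    using quantifier_free_bot[OF A] idn_hom[OF A]
    by (simp add: quantifier_free_def universal_free_def)
  then have "universal_splitting (exfree_subdoctrine P) A \<bottom>\<^bsub>fibre P A\<^esub>"
    by (simp add: reindex_idn A)
  then obtain g where g: "g \<in> homset P A B"
    "reindex P (pairing P p q (Idn P A) g) \<beta> \<sqsubseteq>\<^bsub>fibre P A\<^esub> \<bottom>\<^bsub>fibre P A\<^esub>"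
    using X b le[folded e] unfolding universal_splitting_def exfree_subdoctrine_simps
      exfree_subdoctrine_base by blast
  then show ?thesis using that pairing_section[OF X g(1) A] by blast
qed

text \<open>A term cannot be extracted from the refuted \<forall>a. (\<gamma> \<and> \<not>\<beta>)
  directly, since the conjunction need not be existential-free. Its double negation is, and
  replacing the conjunction by it is harmless because both \<gamma> and \<not>\<beta> are
  regular.\<close>

lemma markov_regular:
  assumes X: "is_product P A B X p q" and c: "existential_free P A \<gamma>"
    and r: "hneg (fibre P A) (hneg (fibre P A) \<gamma>) \<sqsubseteq>\<^bsub>fibre P A\<^esub> \<gamma>"
    and b: "existential_free P X \<beta>"
    and le: "\<gamma> \<sqinter>\<^bsub>fibre P A\<^esub> all_along P p (hneg (fibre P X) \<beta>) \<sqsubseteq>\<^bsub>fibre P A\<^esub> \<bottom>\<^bsub>fibre P A\<^esub>"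
  obtains h where "h \<in> homset P A X" "p \<odot> h = Idn P A"
    "\<gamma> \<sqsubseteq>\<^bsub>fibre P A\<^esub> hneg (fibre P A) (hneg (fibre P A) (reindex P h \<beta>))"
proof -
  have p: "p \<in> homset P X A" using X by (simp add: is_product_def)
  have o: "A \<in> Obj P" "X \<in> Obj P" using p dom_obj cod_obj by (auto simp: homset_def)
  interpret A: heyting_algebra "fibre P A" using o(1) by (rule fibre_heyting)
  interpret X: heyting_algebra "fibre P X" using o(2) by (rule fibre_heyting)
  let ?nA = "hneg (fibre P A)" and ?nX = "hneg (fibre P X)"
  \<comment> \<open>Equivalent to \<not>\<not>(\<gamma> \<and> \<not>\<beta>), but written with
    implication and negation only, which preserve existential-freeness.\<close>
  define \<epsilon> where "\<epsilon> = ?nX (himp (fibre P X) (reindex P p \<gamma>) (?nX (?nX \<beta>)))"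
  have cp: "\<gamma> \<in> pred P A" and bp: "\<beta> \<in> pred P X" using c b exfree_pred by auto
  have pc: "reindex P p \<gamma> \<in> pred P X" using reindex_pred[OF p cp] .
  have e: "existential_free P X \<epsilon>"
    unfolding \<epsilon>_def by (intro exfree_hneg exfree_himp existential_free_reindex[OF p] b c)
  note ep = exfree_pred[OF e]
  obtain s where s: "s \<in> homset P A X" "p \<odot> s = Idn P A"
    using product_section[OF X] .
  have "?nX (?nX (reindex P p \<gamma>)) \<sqsubseteq>\<^bsub>fibre P X\<^esub> reindex P p \<gamma>"
    using reindex_le[OF p r] cp by (simp add: reindex_hneg[OF p])
  then have "\<epsilon> \<sqsubseteq>\<^bsub>fibre P X\<^esub> reindex P p \<gamma>"
    unfolding \<epsilon>_def using pc bp by (intro X.hneg_himp_le) auto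
  then have 1: "all_along P p \<epsilon> \<sqsubseteq>\<^bsub>fibre P A\<^esub> \<gamma>"
    by (rule all_le_section[OF s p ep cp])
  have "\<epsilon> \<sqsubseteq>\<^bsub>fibre P X\<^esub> ?nX (?nX (?nX \<beta>))"
    unfolding \<epsilon>_def using pc bp by (intro X.hneg_himp_le_hneg) auto
  moreover have "?nX (?nX (?nX \<beta>)) \<sqsubseteq>\<^bsub>fibre P X\<^esub> ?nX \<beta>"
    using bp by (intro X.hneg_antimono X.le_hneg_hneg) auto
  ultimately have "\<epsilon> \<sqsubseteq>\<^bsub>fibre P X\<^esub> ?nX \<beta>"
    using ep bp by (meson X.le_trans X.hneg_closed)
  then have 2: "all_along P p \<epsilon> \<sqsubseteq>\<^bsub>fibre P A\<^esub> all_along P p (?nX \<beta>)"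
    using ep bp by (intro all_mono[OF p]) auto
  have "all_along P p \<epsilon> \<sqsubseteq>\<^bsub>fibre P A\<^esub> \<gamma> \<sqinter>\<^bsub>fibre P A\<^esub> all_along P p (?nX \<beta>)"
    using 1 2 cp ep bp all_closed[OF p] by (intro A.meet_le) auto
  then have "all_along P p \<epsilon> \<sqsubseteq>\<^bsub>fibre P A\<^esub> \<bottom>\<^bsub>fibre P A\<^esub>"
    using le cp ep bp all_closed[OF p] by (meson A.le_trans A.meet_closed A.bottom_closed X.hneg_closed)
  then obtain h where h: "h \<in> homset P A X" "p \<odot> h = Idn P A"
    and he: "reindex P h \<epsilon> \<sqsubseteq>\<^bsub>fibre P A\<^esub> \<bottom>\<^bsub>fibre P A\<^esub>"
    by (rule all_le_bot_witness[OF X e])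
  let ?b = "reindex P h \<beta>"
  have hb: "?b \<in> pred P A" using reindex_pred[OF h(1) bp] .
  \<comment> \<open>Since h is a section, \<gamma> returns unchanged; the refuted instance of
    \<epsilon> lies above \<gamma> \<and> \<not>\<beta>(h).\<close>
  have "reindex P h \<epsilon> = ?nA (himp (fibre P A) \<gamma> (?nA (?nA ?b)))"
    unfolding \<epsilon>_def using pc bp cp
    by (simp add: reindex_hneg[OF h(1)] reindex_himp[OF h(1)] reindex_section[OF h(1) p h(2)])
  then have "\<gamma> \<sqinter>\<^bsub>fibre P A\<^esub> ?nA ?b \<sqsubseteq>\<^bsub>fibre P A\<^esub> reindex P h \<epsilon>"
    using A.meet_le_hneg_himp_hneg[of \<gamma> "?nA ?b"] cp hb by simp
  then have "\<gamma> \<sqinter>\<^bsub>fibre P A\<^esub> ?nA ?b \<sqsubseteq>\<^bsub>fibre P A\<^esub> \<bottom>\<^bsub>fibre P A\<^esub>"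
    using he cp hb reindex_pred[OF h(1) ep]
    by (meson A.le_trans A.meet_closed A.bottom_closed A.hneg_closed)
  then have "\<gamma> \<sqsubseteq>\<^bsub>fibre P A\<^esub> ?nA (?nA ?b)"
    using cp hb by (simp add: A.le_hneg_iff)
  with h show ?thesis using that by blast
qed

text \<open>The gain comes from moving to a witnessing predicate \<delta> of \<gamma> \<and>
  \<alpha>: a term chosen for it is correct only up to double negation, yet the instance
  \<open>\<theta>\<close> of \<delta> entails \<alpha> itself. Thus \<open>\<theta>\<close> inherits
  the refutation of \<forall>a. \<alpha>, while \<gamma> still entails
  \<not>\<not>\<open>\<theta>\<close>.\<close>

lemma double_negation_shift_regular:
  assumes X: "is_product P A B X p q" and c: "existential_free P A \<gamma>"
    and r: "hneg (fibre P A) (hneg (fibre P A) \<gamma>) \<sqsubseteq>\<^bsub>fibre P A\<^esub> \<gamma>"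
    and a: "existential_free P X \<alpha>"
    and nn: "\<gamma> \<sqsubseteq>\<^bsub>fibre P A\<^esub> all_along P p (hneg (fibre P X) (hneg (fibre P X) \<alpha>))"
    and le: "\<gamma> \<sqinter>\<^bsub>fibre P A\<^esub> all_along P p \<alpha> \<sqsubseteq>\<^bsub>fibre P A\<^esub> \<bottom>\<^bsub>fibre P A\<^esub>"
  shows "\<gamma> \<sqsubseteq>\<^bsub>fibre P A\<^esub> \<bottom>\<^bsub>fibre P A\<^esub>"
proof -
  have p: "p \<in> homset P X A" using X by (simp add: is_product_def)
  have o: "A \<in> Obj P" "X \<in> Obj P" using p dom_obj cod_obj by (auto simp: homset_def)
  interpret A: heyting_algebra "fibre P A" using o(1) by (rule fibre_heyting)
  interpret X: heyting_algebra "fibre P X" using o(2) by (rule fibre_heyting)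
  let ?nA = "hneg (fibre P A)" and ?nX = "hneg (fibre P X)"
  define \<gamma>' where "\<gamma>' = reindex P p \<gamma>"
  have cp: "\<gamma> \<in> pred P A" and ap: "\<alpha> \<in> pred P X" using c a exfree_pred by auto
  have c': "existential_free P X \<gamma>'" unfolding \<gamma>'_def by (rule existential_free_reindex[OF p c])
  note cp' = exfree_pred[OF c']
  have r': "?nX (?nX \<gamma>') \<sqsubseteq>\<^bsub>fibre P X\<^esub> \<gamma>'"
    unfolding \<gamma>'_def using reindex_le[OF p r] cp by (simp add: reindex_hneg[OF p])
  have nn': "\<gamma>' \<sqsubseteq>\<^bsub>fibre P X\<^esub> ?nX (?nX \<alpha>)"
    unfolding \<gamma>'_def using nn cp ap le_all_iff[OF p, of "?nX (?nX \<alpha>)" \<gamma>] by simp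
  define \<mu> where "\<mu> = \<gamma>' \<sqinter>\<^bsub>fibre P X\<^esub> \<alpha>"
  have mp: "\<mu> \<in> pred P X" unfolding \<mu>_def using cp' ap by simp
  \<comment> \<open>\<open>\<mu>\<close> need not be existential-free, so enough existential-free
    predicates are invoked to present it as an existential.\<close>
  obtain D Y u v \<delta> where Y: "is_product P X D Y u v" and d: "existential_free P Y \<delta>"
    and mu: "\<mu> = ex_along P u \<delta>"
    using enough_exfree o(2) mp unfolding enough_existential_free_def by blast
  note dp = exfree_pred[OF d]
  have u: "u \<in> homset P Y X" using Y by (simp add: is_product_def)
  have "Y \<in> Obj P" using u dom_obj by (auto simp: homset_def)
  then interpret Y: heyting_algebra "fibre P Y" by (rule fibre_heyting)
  let ?nY = "hneg (fibre P Y)"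
  have du: "\<delta> \<sqsubseteq>\<^bsub>fibre P Y\<^esub> reindex P u \<mu>" unfolding mu by (rule le_reindex_ex[OF u dp])
  \<comment> \<open>\<open>\<nu>\<close> says that no witness exists and so entails
    \<not>\<open>\<mu>\<close>. Together with \<open>\<gamma>'\<close> it gives \<not>\<alpha>,
    against \<open>nn'\<close>; this is the premise of \<open>markov_regular\<close> over X.\<close>
  define \<nu> where "\<nu> = all_along P u (?nY \<delta>)"
  have np: "\<nu> \<in> pred P X" unfolding \<nu>_def using dp by (intro all_closed[OF u]) simp
  have "reindex P u \<nu> \<sqsubseteq>\<^bsub>fibre P Y\<^esub> ?nY \<delta>"
    unfolding \<nu>_def using dp by (intro reindex_all_le[OF u]) simp
  then have "\<delta> \<sqsubseteq>\<^bsub>fibre P Y\<^esub> reindex P u (?nX \<nu>)"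
    using np dp reindex_pred[OF u np] by (simp add: reindex_hneg[OF u] Y.le_hneg_commute)
  then have "\<mu> \<sqsubseteq>\<^bsub>fibre P X\<^esub> ?nX \<nu>"
    unfolding mu using np by (simp add: ex_le_iff[OF u dp])
  then have "\<nu> \<sqsubseteq>\<^bsub>fibre P X\<^esub> ?nX \<mu>"
    using np mp by (simp add: X.le_hneg_commute)
  then have "\<nu> \<sqinter>\<^bsub>fibre P X\<^esub> (\<gamma>' \<sqinter>\<^bsub>fibre P X\<^esub> \<alpha>) \<sqsubseteq>\<^bsub>fibre P X\<^esub> \<bottom>\<^bsub>fibre P X\<^esub>"
    using np mp by (simp add: X.le_hneg_iff \<mu>_def)
  then have "\<gamma>' \<sqinter>\<^bsub>fibre P X\<^esub> \<nu> \<sqinter>\<^bsub>fibre P X\<^esub> \<alpha> \<sqsubseteq>\<^bsub>fibre P X\<^esub> \<bottom>\<^bsub>fibre P X\<^esub>"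
    using np cp' ap by (simp add: X.meet_assoc meet_comm[of "fibre P X" \<gamma>' \<nu>])
  then have n1: "\<gamma>' \<sqinter>\<^bsub>fibre P X\<^esub> \<nu> \<sqsubseteq>\<^bsub>fibre P X\<^esub> ?nX \<alpha>"
    using np cp' ap by (simp add: X.le_hneg_iff)
  have n2: "\<gamma>' \<sqinter>\<^bsub>fibre P X\<^esub> \<nu> \<sqsubseteq>\<^bsub>fibre P X\<^esub> ?nX (?nX \<alpha>)"
    using nn' X.meet_left[OF cp' np] np cp' ap by (meson X.le_trans X.meet_closed X.hneg_closed)
  have "\<gamma>' \<sqinter>\<^bsub>fibre P X\<^esub> \<nu>
      \<sqsubseteq>\<^bsub>fibre P X\<^esub> ?nX (?nX \<alpha>) \<sqinter>\<^bsub>fibre P X\<^esub> ?nX \<alpha>"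
    using n1 n2 np cp' ap by (intro X.meet_le) auto
  moreover have "?nX (?nX \<alpha>) \<sqinter>\<^bsub>fibre P X\<^esub> ?nX \<alpha> \<sqsubseteq>\<^bsub>fibre P X\<^esub> \<bottom>\<^bsub>fibre P X\<^esub>"
    using X.le_hneg_iff[of "?nX (?nX \<alpha>)" "?nX \<alpha>"] ap by simp
  ultimately have "\<gamma>' \<sqinter>\<^bsub>fibre P X\<^esub> \<nu> \<sqsubseteq>\<^bsub>fibre P X\<^esub> \<bottom>\<^bsub>fibre P X\<^esub>"
    using np cp' ap by (meson X.le_trans X.meet_closed X.hneg_closed X.bottom_closed)
  then obtain f where f: "f \<in> homset P X Y" "u \<odot> f = Idn P X"
    and fd: "\<gamma>' \<sqsubseteq>\<^bsub>fibre P X\<^esub> ?nX (?nX (reindex P f \<delta>))"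
    unfolding \<nu>_def by (rule markov_regular[OF Y c' r' d])
  define \<theta> where "\<theta> = reindex P f \<delta>"
  have t: "existential_free P X \<theta>" unfolding \<theta>_def by (rule existential_free_reindex[OF f(1) d])
  note tp = exfree_pred[OF t]
  \<comment> \<open>The unit \<open>du\<close> is reindexed along the section f, so no double
    negation enters.\<close>
  have "\<theta> \<sqsubseteq>\<^bsub>fibre P X\<^esub> \<mu>"
    unfolding \<theta>_def using reindex_le[OF f(1) du] dp mp reindex_pred[OF u mp]
    by (simp add: reindex_section[OF f(1) u f(2)])
  then have tc: "\<theta> \<sqsubseteq>\<^bsub>fibre P X\<^esub> reindex P p \<gamma>" and ta: "\<theta> \<sqsubseteq>\<^bsub>fibre P X\<^esub> \<alpha>"
    using X.meet_left[OF cp' ap] X.meet_right[OF cp' ap] tp mp cp' ap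
    unfolding \<mu>_def \<gamma>'_def by (meson X.le_trans)+
  obtain s where s: "s \<in> homset P A X" "p \<odot> s = Idn P A"
    using product_section[OF X] .
  have "all_along P p \<theta> \<sqsubseteq>\<^bsub>fibre P A\<^esub> \<gamma> \<sqinter>\<^bsub>fibre P A\<^esub> all_along P p \<alpha>"
    using all_le_section[OF s p tp cp tc] all_mono[OF p ta tp ap] all_closed[OF p] tp ap cp
    by (intro A.meet_le) auto
  then have "all_along P p \<theta> \<sqsubseteq>\<^bsub>fibre P A\<^esub> \<bottom>\<^bsub>fibre P A\<^esub>"
    using le all_closed[OF p] tp ap cp by (meson A.le_trans A.meet_closed A.bottom_closed)
  then obtain h where h: "h \<in> homset P A X" "p \<odot> h = Idn P A"
    and ht: "reindex P h \<theta> \<sqsubseteq>\<^bsub>fibre P A\<^esub> \<bottom>\<^bsub>fibre P A\<^esub>"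
    by (rule all_le_bot_witness[OF X t])
  have "reindex P h \<gamma>' \<sqsubseteq>\<^bsub>fibre P A\<^esub> reindex P h (?nX (?nX \<theta>))"
    using fd cp' tp unfolding \<theta>_def by (intro reindex_le[OF h(1)]) auto
  then have "\<gamma> \<sqsubseteq>\<^bsub>fibre P A\<^esub> ?nA (?nA (reindex P h \<theta>))"
    using cp tp by (simp add: \<gamma>'_def reindex_section[OF h(1) p h(2)] reindex_hneg[OF h(1)])
  \<comment> \<open>At the refuting instance, \<gamma> entails \<not>\<not>\<bottom>. What remains
    is to cancel this double negation, using that anything entails \<not>\<bottom>.\<close>
  moreover have "reindex P h \<theta> = \<bottom>\<^bsub>fibre P A\<^esub>"
    using ht reindex_pred[OF h(1) tp] by (intro A.le_antisym) auto
  ultimately have "\<gamma> \<sqsubseteq>\<^bsub>fibre P A\<^esub> ?nA (?nA \<bottom>\<^bsub>fibre P A\<^esub>)" by simp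
  moreover have "\<gamma> \<sqsubseteq>\<^bsub>fibre P A\<^esub> ?nA \<bottom>\<^bsub>fibre P A\<^esub>"
    using cp A.meet_right[of \<gamma> "\<bottom>\<^bsub>fibre P A\<^esub>"] by (simp add: A.le_hneg_iff)
  ultimately have "\<gamma> \<sqinter>\<^bsub>fibre P A\<^esub> \<gamma> \<sqsubseteq>\<^bsub>fibre P A\<^esub> \<bottom>\<^bsub>fibre P A\<^esub>"
    using cp A.meet_mono[of \<gamma> "?nA (?nA \<bottom>\<^bsub>fibre P A\<^esub>)" \<gamma> "?nA \<bottom>\<^bsub>fibre P A\<^esub>"]
      A.le_hneg_iff[of "?nA (?nA \<bottom>\<^bsub>fibre P A\<^esub>)" "?nA \<bottom>\<^bsub>fibre P A\<^esub>"]
    by (meson A.le_refl A.le_trans A.meet_closed A.hneg_closed A.bottom_closed)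
  moreover have "\<gamma> \<sqsubseteq>\<^bsub>fibre P A\<^esub> \<gamma> \<sqinter>\<^bsub>fibre P A\<^esub> \<gamma>"
    using cp by (intro A.meet_le) auto
  ultimately show ?thesis
    using cp by (meson A.le_trans A.meet_closed A.bottom_closed)
qed

text \<open>Reduces to the regular case by taking for \<gamma> the double negation of a supposed
  counterexample, \<not>\<phi> \<and> \<psi>.\<close>

lemma double_negation_shift:
  assumes X: "is_product P A B X p q" and a: "existential_free P X \<alpha>"
  shows "hneg (fibre P A) (all_along P p \<alpha>) \<sqsubseteq>\<^bsub>fibre P A\<^esub>
    hneg (fibre P A) (all_along P p (hneg (fibre P X) (hneg (fibre P X) \<alpha>)))"
proof -
  have p: "p \<in> homset P X A" "is_projection P p"
    using X by (auto simp: is_product_def is_projection_def)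
  have o: "A \<in> Obj P" "X \<in> Obj P" using p dom_obj cod_obj by (auto simp: homset_def)
  interpret A: heyting_algebra "fibre P A" using o(1) by (rule fibre_heyting)
  interpret X: heyting_algebra "fibre P X" using o(2) by (rule fibre_heyting)
  let ?nA = "hneg (fibre P A)" and ?nX = "hneg (fibre P X)"
  have all: "existential_free P A (all_along P p \<beta>)" if "existential_free P X \<beta>" for \<beta>
    using all_exfree[OF p(2)] p(1) that by (simp add: homset_def)
  define \<phi> where "\<phi> = all_along P p \<alpha>"
  define \<psi> where "\<psi> = all_along P p (?nX (?nX \<alpha>))"
  \<comment> \<open>Again \<not>\<not>(\<not>\<phi> \<and> \<psi>) in implicational form. As a
    negation it is regular, and it stays below both conjuncts because these are regular:
    \<not>\<phi> as a negation, \<psi> by \<open>all_hneg_hneg_regular\<close>.\<close>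
  define \<gamma> where "\<gamma> = ?nA (himp (fibre P A) (?nA \<phi>) (?nA \<psi>))"
  have e: "existential_free P A \<phi>" "existential_free P A \<psi>"
    unfolding \<phi>_def \<psi>_def by (intro all exfree_hneg a)+
  note ep = e[THEN exfree_pred]
  have c: "existential_free P A \<gamma>"
    unfolding \<gamma>_def by (intro exfree_hneg exfree_himp e)
  note cp = exfree_pred[OF c]
  have r: "?nA (?nA \<gamma>) \<sqsubseteq>\<^bsub>fibre P A\<^esub> \<gamma>"
    unfolding \<gamma>_def using ep by (intro A.hneg_antimono A.le_hneg_hneg) auto
  have "?nA (?nA \<psi>) \<sqsubseteq>\<^bsub>fibre P A\<^esub> \<psi>"
    unfolding \<psi>_def by (rule all_hneg_hneg_regular[OF p(1) exfree_pred[OF a]])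
  moreover have "\<gamma> \<sqsubseteq>\<^bsub>fibre P A\<^esub> ?nA (?nA \<psi>)"
    unfolding \<gamma>_def using ep by (intro A.hneg_himp_le_hneg) auto
  ultimately have c1: "\<gamma> \<sqsubseteq>\<^bsub>fibre P A\<^esub> \<psi>"
    using ep cp by (meson A.le_trans A.hneg_closed)
  have "\<gamma> \<sqsubseteq>\<^bsub>fibre P A\<^esub> ?nA \<phi>"
    unfolding \<gamma>_def using ep by (intro A.hneg_himp_le A.hneg_antimono A.le_hneg_hneg) auto
  then have c2: "\<gamma> \<sqinter>\<^bsub>fibre P A\<^esub> \<phi> \<sqsubseteq>\<^bsub>fibre P A\<^esub> \<bottom>\<^bsub>fibre P A\<^esub>"
    using ep cp by (simp add: A.le_hneg_iff)
  have "\<gamma> \<sqsubseteq>\<^bsub>fibre P A\<^esub> \<bottom>\<^bsub>fibre P A\<^esub>"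
    using double_negation_shift_regular[OF X c r a] c1 c2 unfolding \<phi>_def \<psi>_def by blast
  moreover have "?nA \<phi> \<sqinter>\<^bsub>fibre P A\<^esub> \<psi> \<sqsubseteq>\<^bsub>fibre P A\<^esub> \<gamma>"
    unfolding \<gamma>_def using ep by (intro A.meet_le_hneg_himp_hneg) auto
  ultimately have "?nA \<phi> \<sqinter>\<^bsub>fibre P A\<^esub> \<psi> \<sqsubseteq>\<^bsub>fibre P A\<^esub> \<bottom>\<^bsub>fibre P A\<^esub>"
    using ep cp by (meson A.le_trans A.meet_closed A.hneg_closed A.bottom_closed)
  then show ?thesis
    using ep unfolding \<phi>_def \<psi>_def by (simp add: A.le_hneg_iff)
qed

text \<open>\<open>markov_regular\<close> is applied to \<not>\<alpha>. The double negation in its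
  conclusion disappears because a triple negation reduces to a single one, and the term it supplies
  witnesses the existential.\<close>

lemma markov_principle:
  assumes X: "is_product P A B X p q" and a: "existential_free P X \<alpha>"
  shows "hneg (fibre P A) (all_along P p \<alpha>)
    \<sqsubseteq>\<^bsub>fibre P A\<^esub> ex_along P p (hneg (fibre P X) \<alpha>)"
proof -
  have p: "p \<in> homset P X A" "is_projection P p"
    using X by (auto simp: is_product_def is_projection_def)
  have o: "A \<in> Obj P" "X \<in> Obj P" using p dom_obj cod_obj by (auto simp: homset_def)
  interpret A: heyting_algebra "fibre P A" using o(1) by (rule fibre_heyting)
  interpret X: heyting_algebra "fibre P X" using o(2) by (rule fibre_heyting)
  let ?nA = "hneg (fibre P A)" and ?nX = "hneg (fibre P X)"
  define \<gamma> where "\<gamma> = ?nA (all_along P p \<alpha>)"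
  have ap: "\<alpha> \<in> pred P X" by (rule exfree_pred[OF a])
  have al: "existential_free P A (all_along P p \<alpha>)"
    using all_exfree[OF p(2)] p(1) a by (simp add: homset_def)
  have c: "existential_free P A \<gamma>" unfolding \<gamma>_def by (rule exfree_hneg[OF al])
  note cp = exfree_pred[OF c]
  have r: "?nA (?nA \<gamma>) \<sqsubseteq>\<^bsub>fibre P A\<^esub> \<gamma>"
    unfolding \<gamma>_def using exfree_pred[OF al] by (intro A.hneg_antimono A.le_hneg_hneg) auto
  \<comment> \<open>By definition \<gamma> refutes \<forall>a. \<alpha>, whereas the premise for
    \<not>\<alpha> concerns \<forall>a. \<not>\<not>\<alpha>; the shift bridges the two.\<close>
  have "\<gamma> \<sqinter>\<^bsub>fibre P A\<^esub> all_along P p (?nX (?nX \<alpha>)) \<sqsubseteq>\<^bsub>fibre P A\<^esub> \<bottom>\<^bsub>fibre P A\<^esub>"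
    using double_negation_shift[OF X a] cp ap all_closed[OF p(1)]
    unfolding \<gamma>_def by (simp add: A.le_hneg_iff)
  then obtain h where h: "h \<in> homset P A X" "p \<odot> h = Idn P A"
    and hc: "\<gamma> \<sqsubseteq>\<^bsub>fibre P A\<^esub> ?nA (?nA (reindex P h (?nX \<alpha>)))"
    by (rule markov_regular[OF X c r exfree_hneg[OF a]])
  have ha: "reindex P h \<alpha> \<in> pred P A" by (rule reindex_pred[OF h(1) ap])
  have ec: "ex_along P p (?nX \<alpha>) \<in> pred P A" using ap by (intro ex_closed[OF p(1)]) simp
  have "?nA (?nA (reindex P h (?nX \<alpha>))) \<sqsubseteq>\<^bsub>fibre P A\<^esub> ?nA (reindex P h \<alpha>)"
    using ha ap by (auto simp: reindex_hneg[OF h(1)] intro!: A.hneg_antimono A.le_hneg_hneg)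
  moreover have "?nA (reindex P h \<alpha>) \<sqsubseteq>\<^bsub>fibre P A\<^esub> ex_along P p (?nX \<alpha>)"
    using reindex_le[OF h(1) le_reindex_ex[OF p(1), of "?nX \<alpha>"]] ap ec reindex_pred[OF p(1) ec]
    by (simp add: reindex_section[OF h(1) p(1) h(2)] reindex_hneg[OF h(1)])
  ultimately show ?thesis
    using hc cp ha ec ap unfolding \<gamma>_def
    by (meson A.le_trans A.hneg_closed X.hneg_closed reindex_pred[OF h(1)])
qed

end

theorem corollary5p10:
  fixes P :: "('o, 'm, 'p) doctrine"
  assumes "goedel_hyperdoctrine P"
    and "\<And>A \<alpha> \<beta>. existential_free P A \<alpha> \<Longrightarrow> existential_free P A \<beta> \<Longrightarrow>
      existential_free P A (himp (fibre P A) \<alpha> \<beta>)"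
    and "\<And>A. A \<in> Obj P \<Longrightarrow> quantifier_free P A \<bottom>\<^bsub>fibre P A\<^esub>"
  shows "\<forall>A \<in> Obj P. \<forall>B \<in> Obj P. \<forall>AB \<pi>\<^sub>A \<pi>\<^sub>B \<alpha>\<^sub>D.
    is_product P A B AB \<pi>\<^sub>A \<pi>\<^sub>B \<longrightarrow> quantifier_free P AB \<alpha>\<^sub>D \<longrightarrow>
      \<top>\<^bsub>fibre P B\<^esub> \<sqsubseteq>\<^bsub>fibre P B\<^esub>
        himp (fibre P B) (hneg (fibre P B) (all_along P \<pi>\<^sub>B \<alpha>\<^sub>D))
          (ex_along P \<pi>\<^sub>B (hneg (fibre P AB) \<alpha>\<^sub>D))"
proof (intro ballI allI impI)
  fix A B AB \<pi>\<^sub>A \<pi>\<^sub>B \<alpha>\<^sub>D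
  assume B: "B \<in> Obj P" and AB: "is_product P A B AB \<pi>\<^sub>A \<pi>\<^sub>B"
    and a: "quantifier_free P AB \<alpha>\<^sub>D"
  interpret implicative_goedel_hyperdoctrine P
    using assms by (intro implicative_goedel_hyperdoctrine.intro
        implicative_goedel_hyperdoctrine_axioms.intro)
  have p: "\<pi>\<^sub>B \<in> homset P AB B" using AB by (simp add: is_product_def)
  have "AB \<in> Obj P" using p dom_obj by (auto simp: homset_def)
  then interpret X: heyting_algebra "fibre P AB" by (rule fibre_heyting)
  interpret B: heyting_algebra "fibre P B" using B by (rule fibre_heyting)
  have e: "existential_free P AB \<alpha>\<^sub>D" using a by (simp add: quantifier_free_def)
  let ?l = "hneg (fibre P B) (all_along P \<pi>\<^sub>B \<alpha>\<^sub>D)"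
    and ?r = "ex_along P \<pi>\<^sub>B (hneg (fibre P AB) \<alpha>\<^sub>D)"
  have c: "?l \<in> pred P B" "?r \<in> pred P B"
    using all_closed[OF p] ex_closed[OF p] exfree_pred[OF e] by auto
  have "\<top>\<^bsub>fibre P B\<^esub> \<sqinter>\<^bsub>fibre P B\<^esub> ?l \<sqsubseteq>\<^bsub>fibre P B\<^esub> ?l"
    using c by (intro B.meet_right) auto
  \<comment> \<open>The earlier lemmas quantify over the second factor, so the product span is
    swapped.\<close>
  then have "\<top>\<^bsub>fibre P B\<^esub> \<sqinter>\<^bsub>fibre P B\<^esub> ?l \<sqsubseteq>\<^bsub>fibre P B\<^esub> ?r"
    using markov_principle[OF is_product_commute[OF AB] e] c
    by (meson B.le_trans B.meet_closed B.top_closed)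
  then show "\<top>\<^bsub>fibre P B\<^esub> \<sqsubseteq>\<^bsub>fibre P B\<^esub> himp (fibre P B) ?l ?r"
    using c by (simp add: B.le_himp_iff)
qed

end
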